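(* Let $\mu_1<\mu_2$ be fixed reals, $\alpha\in(0,1)$, let $p=p_N,\ q=q_N\in(0,1]$ satisfy $p>q>0$ and $p,q=\omega(\log N/N)$ as $N\to\infty$, and let $\mathcal{G}=(A,X)\sim\mathrm{CSBM}(N,p,q,\mu_1,\mu_2,\sigma^2)$. Let $r>0$ and fix $n\in\mathbb{N}$. There exists a constant $C=C(r,n)$ (which may also depend on $\mu_1,\mu_2$, but not on $N$) such that with probability at least $1-O(1/N^r)$, $$\mu_2^{\mathrm{APPNP}(n)}-\mu_1^{\mathrm{APPNP}(n)}=\left(\frac{p+q}{p+\frac{2-\alpha}{\alpha}q}+\frac{(2-2\alpha)q}{\alpha p+(2-\alpha)q}(1-\alpha)^n\left(\frac{p-q}{p+q}\right)^n\right)(\mu_2-\mu_1)+\epsilon,$$ where the error term satisfies $|\epsilon|\le C/\sqrt{N(p+q)}$.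
   Context: $\mathrm{CSBM}(N,p,q,\mu_1,\mu_2,\sigma^2)$ (Contextual Stochastic Block Model), $N$ even: the node set $[N]$ is split into two classes $\mathcal{C}_1,\mathcal{C}_2$ of size $N/2$. The symmetric adjacency matrix $A\in\{0,1\}^{N\times N}$ has independent Bernoulli entries $A_{uv}$, $u\le v$, with parameter $p$ if $u,v$ are in the same class and $q$ otherwise. Independently, $X\in\mathbb{R}^N$ has independent entries $X_v\sim\mathcal{N}(\mu_i,\sigma^2)$ for $v\in\mathcal{C}_i$. $D=\mathrm{diag}(A\mathbf{1}_N)$ is the degree matrix (in the stated regime all degrees are positive with high probability; high-probability events are understood to include this). APPNP with teleportation probability $\alpha$ is defined by $h^{\mathrm{APPNP}(0)}=X$ and $h^{\mathrm{APPNP}(n+1)}=(1-\alpha)(D^{-1}A)h^{\mathrm{APPNP}(n)}+\alpha X$; equivalently $h^{\mathrm{APPNP}(n)}=M_nX$ with $M_n=\alpha\sum_{k=0}^{n-1}(1-\alpha)^k(D^{-1}A)^k+(1-\alpha)^n(D^{-1}A)^n$. Let $\mu\in\mathbb{R}^N$ have $\mu_v=\mu_i$ for $v\in\mathcal{C}_i$. Then $\mu_i^{\mathrm{APPNP}(n)}=\frac{1}{N/2}\sum_{v\in\mathcal{C}_i}(M_n\mu)_v$ is the class-$i$ average of the conditional means of $h^{\mathrm{APPNP}(n)}$ given $A$. The probability is over the random graph $A$. *)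

theory Defs
  imports
    "HOL-Probability.Probability"
    "HOL-Library.Landau_Symbols"
    "Jordan_Normal_Form.Matrix"
begin

unbundle no vec_syntax

text \<open>The filter \<open>N \<rightarrow> \<infinity>\<close> along even \<open>N\<close>: the model only exists for even \<open>N\<close>.\<close>

abbreviation even_at_top :: "nat filter" where
  "even_at_top \<equiv> inf at_top (principal {N. even N})"

text \<open>The node set is \<open>{..<N}\<close>. The cardinality conditions together force \<open>N\<close> to be even.\<close>

definition balanced_classes :: "nat \<Rightarrow> nat set \<Rightarrow> nat set \<Rightarrow> bool" where
  "balanced_classes N C1 C2 \<longleftrightarrow>
     C1 \<union> C2 = {..<N} \<and> C1 \<inter> C2 = {} \<and> 2 * card C1 = N \<and> 2 * card C2 = N"

text \<open>The independent Bernoulli variables are those indexed by \<open>u \<le> v\<close> (self-loops included);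
  the remaining entries are filled in by symmetry.\<close>

definition edge_pmf :: "nat \<Rightarrow> nat set \<Rightarrow> real \<Rightarrow> real \<Rightarrow> (nat \<times> nat \<Rightarrow> bool) pmf" where
  "edge_pmf N C1 p q =
     Pi_pmf {(u, v). u \<le> v \<and> v < N} False
       (\<lambda>(u, v). bernoulli_pmf (if u \<in> C1 \<longleftrightarrow> v \<in> C1 then p else q))"

definition adj_mat :: "nat \<Rightarrow> (nat \<times> nat \<Rightarrow> bool) \<Rightarrow> real mat" where
  "adj_mat N E = mat N N (\<lambda>(u, v). of_bool (E (min u v, max u v)))"

definition sbm :: "nat \<Rightarrow> nat set \<Rightarrow> real \<Rightarrow> real \<Rightarrow> real mat pmf" where
  "sbm N C1 p q = map_pmf (adj_mat N) (edge_pmf N C1 p q)"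

definition class_value :: "nat set \<Rightarrow> real \<Rightarrow> real \<Rightarrow> nat \<Rightarrow> real" where
  "class_value C1 \<mu>1 \<mu>2 v = (if v \<in> C1 then \<mu>1 else \<mu>2)"

definition feature_measure :: "nat \<Rightarrow> nat set \<Rightarrow> real \<Rightarrow> real \<Rightarrow> real \<Rightarrow> (nat \<Rightarrow> real) measure" where
  "feature_measure N C1 \<mu>1 \<mu>2 \<sigma> =
     PiM {..<N} (\<lambda>v. density lborel (normal_density (class_value C1 \<mu>1 \<mu>2 v) \<sigma>))"

text \<open>The joint law of \<open>(A, X)\<close>; \<open>\<sigma>\<close> is the standard deviation of the features.\<close>

definition csbm :: "nat \<Rightarrow> nat set \<Rightarrow> real \<Rightarrow> real \<Rightarrow> real \<Rightarrow> real \<Rightarrow> real \<Rightarrow>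
    (real mat \<times> (nat \<Rightarrow> real)) measure" where
  "csbm N C1 p q \<mu>1 \<mu>2 \<sigma> =
     measure_pmf (sbm N C1 p q) \<Otimes>\<^sub>M feature_measure N C1 \<mu>1 \<mu>2 \<sigma>"

definition node_degree :: "real mat \<Rightarrow> nat \<Rightarrow> real" where
  "node_degree A v = (\<Sum>u<dim_col A. A $$ (v, u))"

text \<open>This is \<open>D\<^sup>-\<^sup>1 A\<close> when all degrees are positive; a row of an isolated node is \<open>0\<close>.\<close>

definition walk_mat :: "real mat \<Rightarrow> real mat" where
  "walk_mat A = mat_diag (dim_row A) (\<lambda>v. 1 / node_degree A v) * A"

fun appnp :: "real \<Rightarrow> real mat \<Rightarrow> real vec \<Rightarrow> nat \<Rightarrow> real vec" where
  "appnp \<alpha> A X 0 = X"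
| "appnp \<alpha> A X (Suc n) = (1 - \<alpha>) \<cdot>\<^sub>v (walk_mat A *\<^sub>v appnp \<alpha> A X n) + \<alpha> \<cdot>\<^sub>v X"

definition appnp_mat :: "real \<Rightarrow> real mat \<Rightarrow> nat \<Rightarrow> real mat" where
  "appnp_mat \<alpha> A n = mat (dim_row A) (dim_row A) (\<lambda>(u, v).
     \<alpha> * (\<Sum>k<n. (1 - \<alpha>) ^ k * (walk_mat A ^\<^sub>m k) $$ (u, v))
       + (1 - \<alpha>) ^ n * (walk_mat A ^\<^sub>m n) $$ (u, v))"

text \<open>\<open>appnp_class_mean \<alpha> n A C m\<close> is the average over the class \<open>C\<close> of \<open>M\<^sub>n m\<close>.\<close>

definition appnp_class_mean :: "real \<Rightarrow> nat \<Rightarrow> real mat \<Rightarrow> nat set \<Rightarrow> (nat \<Rightarrow> real) \<Rightarrow> real" where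
  "appnp_class_mean \<alpha> n A C m =
     1 / (real (dim_row A) / 2) *
       (\<Sum>v\<in>C. (appnp_mat \<alpha> A n *\<^sub>v vec (dim_row A) m) $ v)"

lemma walk_mat_carrier: "A \<in> carrier_mat N N \<Longrightarrow> walk_mat A \<in> carrier_mat N N"
  by (auto simp: walk_mat_def mat_diag_def)

lemma pow_mat_Suc_left:
  fixes W :: "real mat"
  assumes "W \<in> carrier_mat N N"
  shows "W ^\<^sub>m Suc k = W * W ^\<^sub>m k"
proof (induction k)
  case 0
  show ?case using assms by auto
next
  case (Suc k)
  have "W ^\<^sub>m Suc (Suc k) = (W * W ^\<^sub>m k) * W" using Suc by simp
  also have "\<dots> = W * (W ^\<^sub>m k * W)"
    by (rule assoc_mult_mat[of _ N N _ N _ N]) (use assms in auto)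
  finally show ?case by simp
qed

lemma appnp_mat_Suc:
  assumes A: "A \<in> carrier_mat N N"
  shows "appnp_mat \<alpha> A (Suc n) = (1 - \<alpha>) \<cdot>\<^sub>m (walk_mat A * appnp_mat \<alpha> A n) + \<alpha> \<cdot>\<^sub>m 1\<^sub>m N"
proof (rule eq_matI, goal_cases)
  case (1 i j)
  define W where "W = walk_mat A"
  have W: "W \<in> carrier_mat N N" using walk_mat_carrier[OF A] by (simp add: W_def)
  have ij: "i < N" "j < N" using 1 A by auto
  have step: "(W ^\<^sub>m Suc k) $$ (i, j) = (\<Sum>w<N. W $$ (i, w) * (W ^\<^sub>m k) $$ (w, j))" for k
    unfolding pow_mat_Suc_left[OF W] using W ij
    by (auto simp: scalar_prod_def lessThan_atLeast0 intro!: sum.cong)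
  have "(walk_mat A * appnp_mat \<alpha> A n) $$ (i, j)
      = (\<Sum>w<N. W $$ (i, w) * (\<alpha> * (\<Sum>k<n. (1 - \<alpha>) ^ k * (W ^\<^sub>m k) $$ (w, j))
          + (1 - \<alpha>) ^ n * (W ^\<^sub>m n) $$ (w, j)))"
    using W ij A unfolding W_def
    by (auto simp: scalar_prod_def lessThan_atLeast0 appnp_mat_def intro!: sum.cong)
  also have "\<dots> = \<alpha> * (\<Sum>w<N. \<Sum>k<n. (1 - \<alpha>) ^ k * (W $$ (i, w) * (W ^\<^sub>m k) $$ (w, j)))
      + (1 - \<alpha>) ^ n * (\<Sum>w<N. W $$ (i, w) * (W ^\<^sub>m n) $$ (w, j))"
    by (simp add: sum_distrib_left sum_distrib_right sum.distrib algebra_simps)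
  also have "(\<Sum>w<N. \<Sum>k<n. (1 - \<alpha>) ^ k * (W $$ (i, w) * (W ^\<^sub>m k) $$ (w, j)))
      = (\<Sum>k<n. (1 - \<alpha>) ^ k * (W ^\<^sub>m Suc k) $$ (i, j))"
    by (subst sum.swap) (simp only: step sum_distrib_left)
  finally have prod: "(walk_mat A * appnp_mat \<alpha> A n) $$ (i, j)
      = \<alpha> * (\<Sum>k<n. (1 - \<alpha>) ^ k * (W ^\<^sub>m Suc k) $$ (i, j))
        + (1 - \<alpha>) ^ n * (W ^\<^sub>m Suc n) $$ (i, j)"
    by (simp only: step)
  have "appnp_mat \<alpha> A (Suc n) $$ (i, j)
      = \<alpha> * ((1\<^sub>m N) $$ (i, j) + (\<Sum>k<n. (1 - \<alpha>) ^ Suc k * (W ^\<^sub>m Suc k) $$ (i, j)))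
        + (1 - \<alpha>) ^ Suc n * (W ^\<^sub>m Suc n) $$ (i, j)"
    using ij A W unfolding appnp_mat_def W_def[symmetric] sum.lessThan_Suc_shift by simp
  also have "\<dots> = (1 - \<alpha>) * (walk_mat A * appnp_mat \<alpha> A n) $$ (i, j) + \<alpha> * (1\<^sub>m N) $$ (i, j)"
    unfolding prod by (simp add: sum_distrib_left algebra_simps del: pow_mat.simps)
  finally show ?case
    using ij A W by (simp add: W_def appnp_mat_def del: index_mult_mat(1))
qed (use A in \<open>auto simp: appnp_mat_def walk_mat_def mat_diag_def\<close>)

lemma smult_mat_mult_vec:
  fixes c :: real
  assumes "B \<in> carrier_mat N N" "x \<in> carrier_vec N"
  shows "(c \<cdot>\<^sub>m B) *\<^sub>v x = c \<cdot>\<^sub>v (B *\<^sub>v x)"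
  by (rule eq_vecI) (use assms in \<open>auto simp: scalar_prod_def sum_distrib_left mult.assoc\<close>)

lemma appnp_mat_carrier: "A \<in> carrier_mat N N \<Longrightarrow> appnp_mat \<alpha> A n \<in> carrier_mat N N"
  by (auto simp: appnp_mat_def)

text \<open>The closed form \<open>h\<^sup>(\<^sup>n\<^sup>) = M\<^sub>n X\<close> of the recursion.\<close>

lemma appnp_eq_appnp_mat:
  assumes A: "A \<in> carrier_mat N N" and X: "X \<in> carrier_vec N"
  shows "appnp \<alpha> A X n = appnp_mat \<alpha> A n *\<^sub>v X"
proof (induction n)
  case 0
  have "appnp_mat \<alpha> A 0 = 1\<^sub>m N"
    using A by (auto simp: appnp_mat_def walk_mat_def mat_diag_def)
  then show ?case using X by simp
next
  case (Suc n)
  define W where "W = walk_mat A"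
  define M where "M = appnp_mat \<alpha> A n"
  have W: "W \<in> carrier_mat N N" using walk_mat_carrier[OF A] by (simp add: W_def)
  have M: "M \<in> carrier_mat N N" using appnp_mat_carrier[OF A] by (simp add: M_def)
  have "appnp_mat \<alpha> A (Suc n) *\<^sub>v X = ((1 - \<alpha>) \<cdot>\<^sub>m (W * M)) *\<^sub>v X + (\<alpha> \<cdot>\<^sub>m 1\<^sub>m N) *\<^sub>v X"
    unfolding appnp_mat_Suc[OF A] W_def[symmetric] M_def[symmetric]
    by (rule add_mult_distrib_mat_vec[of _ N N]) (use W M X in auto)
  also have "((1 - \<alpha>) \<cdot>\<^sub>m (W * M)) *\<^sub>v X = (1 - \<alpha>) \<cdot>\<^sub>v (W *\<^sub>v (M *\<^sub>v X))"
    using W M X by (subst smult_mat_mult_vec[of _ N]) auto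
  also have "(\<alpha> \<cdot>\<^sub>m 1\<^sub>m N) *\<^sub>v X = \<alpha> \<cdot>\<^sub>v X"
    using X by (subst smult_mat_mult_vec[of _ N]) auto
  finally show ?case using Suc by (simp add: W_def M_def)
qed

lemma feature_component:
  assumes "\<sigma> > 0" "v < N"
  shows "integrable (feature_measure N C1 \<mu>1 \<mu>2 \<sigma>) (\<lambda>X. X v)"
    and "(\<integral>X. X v \<partial>feature_measure N C1 \<mu>1 \<mu>2 \<sigma>) = class_value C1 \<mu>1 \<mu>2 v"
proof -
  let ?c = "class_value C1 \<mu>1 \<mu>2"
  let ?D = "\<lambda>v. density lborel (normal_density (?c v) \<sigma>)"
  let ?M = "feature_measure N C1 \<mu>1 \<mu>2 \<sigma>"
  have d: "distr ?M (?D v) (\<lambda>X. X v) = ?D v"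
    unfolding feature_measure_def
    by (rule distr_PiM_component) (use assms in \<open>auto intro: prob_space_normal_density\<close>)
  have m: "(\<lambda>X. X v) \<in> measurable ?M (?D v)"
    unfolding feature_measure_def using assms by (intro measurable_component_singleton) auto
  have i: "integrable (?D v) (\<lambda>x. x)"
    by (subst integrable_density) (use assms in \<open>auto intro!: integrable_normal_moment_nz_1\<close>)
  have e: "(\<integral>x. x \<partial>?D v) = ?c v"
    by (subst integral_density) (use assms in \<open>auto simp: integral_normal_moment_nz_1\<close>)
  show "integrable ?M (\<lambda>X. X v)"
    by (rule integrable_distr[OF m]) (subst d, rule i)
  show "(\<integral>X. X v \<partial>?M) = ?c v"
    using integral_distr[OF m, of "\<lambda>x. x", unfolded d e] by simp
qed

text \<open>As \<open>A\<close> and \<open>X\<close> are independent, integrating \<open>h\<^sup>(\<^sup>n\<^sup>)\<close> over the law of \<open>X\<close> with \<open>A\<close> held fixed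
  gives the conditional mean given \<open>A\<close>; its class average is \<open>appnp_class_mean\<close>.\<close>

lemma appnp_class_mean_eq_average_mean:
  assumes A: "A \<in> carrier_mat N N" and \<sigma>: "\<sigma> > 0" and C: "C \<subseteq> {..<N}"
  shows "appnp_class_mean \<alpha> n A C (class_value C1 \<mu>1 \<mu>2) =
    1 / (real N / 2) *
      (\<Sum>v\<in>C. \<integral>X. appnp \<alpha> A (vec N X) n $ v \<partial>feature_measure N C1 \<mu>1 \<mu>2 \<sigma>)"
proof -
  have "(\<integral>X. appnp \<alpha> A (vec N X) n $ v \<partial>feature_measure N C1 \<mu>1 \<mu>2 \<sigma>)
      = (appnp_mat \<alpha> A n *\<^sub>v vec N (class_value C1 \<mu>1 \<mu>2)) $ v" if v: "v \<in> C" for v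
  proof -
    have *: "(appnp_mat \<alpha> A n *\<^sub>v vec N X) $ v = (\<Sum>u<N. appnp_mat \<alpha> A n $$ (v, u) * X u)" for X
      using v C A appnp_mat_carrier[OF A, of \<alpha> n]
      by (auto simp: scalar_prod_def lessThan_atLeast0 intro!: sum.cong)
    show ?thesis
      unfolding appnp_eq_appnp_mat[OF A vec_carrier] *
      by (subst Bochner_Integration.integral_sum)
         (auto simp: feature_component[OF \<sigma>])
  qed
  with A show ?thesis by (auto simp: appnp_class_mean_def)
qed

end

theory Submission
  imports Defs "HOL-Real_Asymp.Real_Asymp"
begin

text \<open>Let \<open>s = \<plusminus>1\<close> be the class indicator, \<open>P = D\<^sup>-\<^sup>1 A\<close>, \<open>\<Lambda> = (p - q) / (p + q)\<close> and \<open>d = N (p + q) / 2\<close>.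
  For the averaged graph \<open>P s = \<Lambda> s\<close>, and the iteration yields exactly the claimed coefficient of
  \<open>\<mu>2 - \<mu>1\<close>. Because \<open>A\<close> is symmetric, \<open>P\<close> is a contraction in the degree-weighted Euclidean norm,
  so the error after \<open>n\<close> steps is at most \<open>n\<close> times the norm of the defect \<open>P s - \<Lambda> s\<close>, up to constants.
  The entries of the defect are \<open>1 / D\<close> times centred row sums of \<open>A\<close>. Bounding them individually would
  cost a logarithmic factor; instead, the sum of their squares is shown to be \<open>O(d N)\<close> outside an
  event of probability \<open>O(exp (- N) + N exp (- c d))\<close>: the row sums of the upper and of the strictly lower
  triangle are independent within each triangle, and their truncated squares, divided by \<open>8 d\<close>,
  have bounded exponential moments.\<close>

section \<open>Exponential moments and tails of sums of independent Bernoulli variables\<close>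

lemma exp_le_quadratic:
  fixes x :: real
  assumes "\<bar>x\<bar> \<le> 1"
  shows "exp x \<le> 1 + x + x\<^sup>2"
proof (cases "x \<ge> 0")
  case True
  then show ?thesis using exp_bound[of x] assms by auto
next
  case False
  define y where "y = - x"
  have y: "0 \<le> y" "y \<le> 1" using False assms by (auto simp: y_def)
  have "1 + y + y\<^sup>2 / 2 \<le> exp y"
    using exp_lower_Taylor_quadratic[OF y(1)] by simp
  \<comment> \<open>The Taylor polynomial bounds exp y from below, so a product of at least 1 makes
    its partner 1 - y + y^2 an upper bound for exp (- y).\<close>
  moreover have "1 \<le> (1 + y + y\<^sup>2 / 2) * (1 - y + y\<^sup>2)"
  proof -
    have "(1 + y + y\<^sup>2 / 2) * (1 - y + y\<^sup>2) = 1 + (y\<^sup>2 + y ^ 3 + y ^ 4) / 2"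
      by (simp add: field_simps power2_eq_square power3_eq_cube power4_eq_xxxx)
    then show ?thesis using y by simp
  qed
  moreover have "0 \<le> 1 - y + y\<^sup>2" using y by (simp add: add_increasing2)
  ultimately have "1 \<le> exp y * (1 - y + y\<^sup>2)"
    by (meson mult_right_mono order_trans)
  then have "exp (- y) * 1 \<le> exp (- y) * (exp y * (1 - y + y\<^sup>2))"
    by (intro mult_left_mono) auto
  also have "\<dots> = 1 - y + y\<^sup>2"
    by (simp add: exp_minus field_simps)
  finally show ?thesis by (simp add: y_def)
qed

lemma pmf_markov_exp:
  fixes Y :: "'a \<Rightarrow> real"
  assumes "finite (set_pmf M)"
  shows "measure_pmf.prob M {x. y \<le> Y x} \<le> exp (- y) * measure_pmf.expectation M (\<lambda>x. exp (Y x))"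
proof -
  have "measure_pmf.prob M {x. y \<le> Y x} = measure_pmf.expectation M (indicator {x. y \<le> Y x})"
    by simp
  also have "\<dots> \<le> measure_pmf.expectation M (\<lambda>x. exp (- y) * exp (Y x))"
    by (intro integral_mono integrable_measure_pmf_finite assms)
       (auto simp: indicator_def exp_add[symmetric] algebra_simps)
  finally show ?thesis by simp
qed

text \<open>One variable per potential edge, each with a bounded weight. In the moment and tail
  bounds, \<open>d\<close> dominates the mean edge count of a block \<open>J\<close> and therefore
  its variance. The weights are a parameter because an edge may enter the rows of its two endpoints
  with different weights.\<close>

locale bernoulli_field =
  fixes I :: "'e set" and \<pi> w :: "'e \<Rightarrow> real" and d :: real
  assumes finite_I: "finite I"
    and \<pi>: "\<And>e. e \<in> I \<Longrightarrow> 0 \<le> \<pi> e \<and> \<pi> e \<le> 1"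
    and w: "\<And>e. e \<in> I \<Longrightarrow> \<bar>w e\<bar> \<le> 1"
    and d: "d > 0"
begin

definition M :: "('e \<Rightarrow> bool) pmf" where
  "M = Pi_pmf I False (\<lambda>e. bernoulli_pmf (\<pi> e))"

definition Y :: "'e set \<Rightarrow> ('e \<Rightarrow> bool) \<Rightarrow> real" where
  "Y J E = (\<Sum>e\<in>J. w e * (of_bool (E e) - \<pi> e))"

lemma finite_M: "finite (set_pmf M)"
  unfolding M_def using finite_I
  by (subst set_Pi_pmf) (auto intro!: finite_PiE_dflt)

text \<open>Independence factors the expectation edge by edge. In each factor
  \<open>exp_le_quadratic\<close> leaves 1 plus a multiple of the variance, since centring removes
  the linear term. The restriction on \<open>t\<close> keeps the exponents in the range of that
  bound.\<close>

lemma mgf: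
  assumes J: "J \<subseteq> I" "sum \<pi> J \<le> d" and t: "\<bar>t\<bar> \<le> 1"
  shows "measure_pmf.expectation M (\<lambda>E. exp (t * Y J E)) \<le> exp (d * t\<^sup>2)"
proof -
  \<comment> \<open>Setting the factor to 1 outside \<open>J\<close> lets the product run over all
    of \<open>I\<close>, the index set of the product law.\<close>
  define f where "f e b = (if e \<in> J then exp (t * (w e * (of_bool b - \<pi> e))) else 1)" for e b
  have fJ: "finite J" using J finite_I finite_subset by blast
  have "exp (t * Y J E) = (\<Prod>e\<in>I. f e (E e))" for E
  proof -
    have "exp (t * Y J E) = (\<Prod>e\<in>J. exp (t * (w e * (of_bool (E e) - \<pi> e))))"
      by (simp add: Y_def sum_distrib_left exp_sum[OF fJ])
    also have "\<dots> = (\<Prod>e\<in>I. f e (E e))"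
      unfolding f_def using J finite_I by (intro prod.mono_neutral_cong_left) auto
    finally show ?thesis .
  qed
  then have "measure_pmf.expectation M (\<lambda>E. exp (t * Y J E))
      = measure_pmf.expectation M (\<lambda>E. \<Prod>e\<in>I. f e (E e))" by simp
  also have "\<dots> = (\<Prod>e\<in>I. measure_pmf.expectation (bernoulli_pmf (\<pi> e)) (f e))"
    unfolding M_def using finite_I
    by (subst expectation_prod_Pi_pmf) (auto intro!: integrable_measure_pmf_finite simp: f_def)
  also have "\<dots> \<le> (\<Prod>e\<in>I. if e \<in> J then exp (t\<^sup>2 * \<pi> e) else 1)"
  proof (intro prod_mono conjI)
    fix e assume e: "e \<in> I"
    show "0 \<le> measure_pmf.expectation (bernoulli_pmf (\<pi> e)) (f e)"
      by (intro integral_nonneg_AE) (auto simp: f_def)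
    show "measure_pmf.expectation (bernoulli_pmf (\<pi> e)) (f e)
        \<le> (if e \<in> J then exp (t\<^sup>2 * \<pi> e) else 1)"
    proof (cases "e \<in> J")
      case True
      define x where "x = t * w e"
      have x: "\<bar>x\<bar> \<le> 1" "x\<^sup>2 \<le> t\<^sup>2"
        using w[OF e] t by (auto simp: x_def abs_mult power_mult_distrib abs_square_le_1 
            intro!: mult_le_one mult_left_le)
      have p: "0 \<le> \<pi> e" "\<pi> e \<le> 1" using \<pi>[OF e] by auto
      have "measure_pmf.expectation (bernoulli_pmf (\<pi> e)) (f e)
          = \<pi> e * exp (x * (1 - \<pi> e)) + (1 - \<pi> e) * exp (- x * \<pi> e)"
        using True p by (simp add: f_def x_def mult.assoc)
      also have "\<dots> \<le> \<pi> e * (1 + x * (1 - \<pi> e) + (x * (1 - \<pi> e))\<^sup>2)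
          + (1 - \<pi> e) * (1 + (- x * \<pi> e) + (- x * \<pi> e)\<^sup>2)"
        using x p by (intro add_mono mult_left_mono exp_le_quadratic)
          (auto simp: abs_mult intro!: mult_le_one)
      also have "\<dots> = 1 + x\<^sup>2 * (\<pi> e * (1 - \<pi> e))"
        by (simp add: power2_eq_square algebra_simps)
      also have "\<dots> \<le> 1 + t\<^sup>2 * \<pi> e"
        using x p by (intro add_left_mono mult_mono) (auto simp: mult_left_le)
      also have "\<dots> \<le> exp (t\<^sup>2 * \<pi> e)" by (rule exp_ge_add_one_self)
      finally show ?thesis using True by simp
    qed (simp add: f_def[abs_def])
  qed
  also have "\<dots> = (\<Prod>e\<in>J. exp (t\<^sup>2 * \<pi> e))"
    using J finite_I by (intro prod.mono_neutral_cong_right) auto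
  also have "\<dots> = exp (t\<^sup>2 * sum \<pi> J)"
    by (simp add: sum_distrib_left exp_sum[OF fJ])
  also have "\<dots> \<le> exp (d * t\<^sup>2)"
    using mult_right_mono[OF J(2), of "t\<^sup>2"] by (simp add: mult.commute)
  finally show ?thesis .
qed

lemma tail:
  assumes J: "J \<subseteq> I" "sum \<pi> J \<le> d" and y: "0 \<le> y" "y \<le> 2 * d"
  shows "measure_pmf.prob M {E. y \<le> \<bar>Y J E\<bar>} \<le> 2 * exp (- (y\<^sup>2 / (4 * d)))"
proof -
  have one: "measure_pmf.prob M {E. y \<le> s * Y J E} \<le> exp (- (y\<^sup>2 / (4 * d)))"
    if s: "\<bar>s\<bar> = 1" for s
  proof -
    \<comment> \<open>This minimises d t^2 - t y, and y \<le> 2 d is exactly what keeps it in the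
      range of \<open>mgf\<close>. The sign \<open>s\<close> serves both tails.\<close>
    define t where "t = y / (2 * d)"
    have t: "\<bar>s * t\<bar> \<le> 1" "t \<ge> 0" using y d s by (auto simp: t_def abs_mult)
    have "measure_pmf.prob M {E. y \<le> s * Y J E} \<le> measure_pmf.prob M {E. t * y \<le> (s * t) * Y J E}"
    proof (intro measure_pmf.finite_measure_mono subsetI CollectI)
      fix E assume "E \<in> {E. y \<le> s * Y J E}"
      then have "t * y \<le> t * (s * Y J E)" using t by (intro mult_left_mono) auto
      then show "t * y \<le> (s * t) * Y J E" by (simp add: ac_simps)
    qed auto
    also have "\<dots> \<le> exp (- (t * y)) * measure_pmf.expectation M (\<lambda>E. exp ((s * t) * Y J E))"
      by (rule pmf_markov_exp[OF finite_M])
    also have "\<dots> \<le> exp (- (t * y)) * exp (d * (s * t)\<^sup>2)"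
      using t by (intro mult_left_mono mgf J) auto
    also have "\<dots> = exp (- (t * y) + d * (s * t)\<^sup>2)" by (rule mult_exp_exp)
    also have "- (t * y) + d * (s * t)\<^sup>2 = - (y\<^sup>2 / (4 * d))"
    proof -
      have "s\<^sup>2 = 1" using s by (metis one_power2 power2_abs)
      then show ?thesis using d
        by (simp add: t_def power_mult_distrib field_simps power2_eq_square)
    qed
    finally show ?thesis .
  qed
  have "measure_pmf.prob M {E. y \<le> \<bar>Y J E\<bar>}
      \<le> measure_pmf.prob M ({E. y \<le> 1 * Y J E} \<union> {E. y \<le> (-1) * Y J E})"
    by (intro measure_pmf.finite_measure_mono) auto
  also have "\<dots> \<le> measure_pmf.prob M {E. y \<le> 1 * Y J E} + measure_pmf.prob M {E. y \<le> (-1) * Y J E}"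
    by (rule measure_Un_le) auto
  also have "\<dots> \<le> 2 * exp (- (y\<^sup>2 / (4 * d)))"
    using one[of 1] one[of "-1"] by simp
  finally show ?thesis .
qed

text \<open>The Gaussian tail bound for \<open>Y J\<close> is only available up to \<open>2 * d\<close>; beyond it the square
  is not exponentially integrable uniformly in \<open>d\<close>, hence the truncation.\<close>

definition trunc_sq :: "real \<Rightarrow> real" where
  "trunc_sq y = (if \<bar>y\<bar> \<le> d / 4 then y\<^sup>2 / (8 * d) else 0)"

text \<open>Summation over integer levels. Dividing the square by 8 d, twice the 4 d of
  \<open>tail\<close>, makes level k have probability at most 2 exp (- 2 k), which beats the value
  exp (k + 1) taken there. The geometric series gives at most 4 e, and 4 \<le> e^2.\<close>

lemma expectation_exp_trunc_sq:
  assumes J: "J \<subseteq> I" "sum \<pi> J \<le> d"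
  shows "measure_pmf.expectation M (\<lambda>E. exp (trunc_sq (Y J E))) \<le> exp 3"
proof -
  \<comment> \<open>\<open>K\<close> only keeps the sum over levels finite; the final bound does not
    depend on it.\<close>
  define K where "K = nat \<lceil>d\<rceil>"
  have K: "d \<le> real K" using d by (simp add: K_def)
  define Z where "Z E = trunc_sq (Y J E)" for E
  have Z: "0 \<le> Z E" "Z E < real K + 1" for E
  proof -
    have "(Y J E)\<^sup>2 \<le> d\<^sup>2" if "\<bar>Y J E\<bar> \<le> d / 4"
      using that d by (intro abs_le_square_iff[THEN iffD1]) auto
    moreover have "d\<^sup>2 \<le> d * (8 * d)" using d by (simp add: power2_eq_square)
    ultimately have "(Y J E)\<^sup>2 / (8 * d) \<le> d" if "\<bar>Y J E\<bar> \<le> d / 4"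
      using that d by (subst pos_divide_le_eq) (auto intro: order_trans)
    then show "Z E < real K + 1" using K d by (auto simp: Z_def trunc_sq_def)
    show "0 \<le> Z E" using d by (auto simp: Z_def trunc_sq_def)
  qed
  have layer: "exp (Z E) \<le> (\<Sum>k\<le>K. exp (real k + 1) * indicator {E. real k \<le> Z E} E)" for E
  proof -
    define k where "k = nat \<lfloor>Z E\<rfloor>"
    have k: "real k \<le> Z E" "Z E < real k + 1" using Z[of E] by (auto simp: k_def)
    then have kK: "k \<in> {..K}" using Z(2)[of E] by auto
    have "exp (Z E) \<le> exp (real k + 1) * indicator {E. real k \<le> Z E} E"
      using k by simp
    also have "\<dots> \<le> (\<Sum>k\<le>K. exp (real k + 1) * indicator {E. real k \<le> Z E} E)"
      using kK by (intro member_le_sum) auto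
    finally show ?thesis .
  qed
  have prob_Z: "measure_pmf.prob M {E. real k \<le> Z E} \<le> 2 * exp (- 2 * real k)" for k
  proof (cases "\<exists>E. real k \<le> Z E")
    case False
    then show ?thesis by simp
  next
    case True
    \<comment> \<open>The deviation at which the square, before truncation, reaches level k. If a
      positive level is attained at all, the truncation forces y \<le> d / 4, so \<open>tail\<close>
      applies; levels never attained were split off for this reason.\<close>
    define y where "y = sqrt (8 * d * real k)"
    have y0: "0 \<le> y" using d by (simp add: y_def)
    have imp: "y \<le> \<bar>Y J E\<bar> \<and> (k > 0 \<longrightarrow> y \<le> d / 4)" if E: "real k \<le> Z E" for E
    proof (cases "\<bar>Y J E\<bar> \<le> d / 4")
      case True
      then have "8 * d * real k \<le> (Y J E)\<^sup>2" 
        using E d by (simp add: Z_def trunc_sq_def field_simps)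
      then have "y \<le> \<bar>Y J E\<bar>" unfolding y_def by (intro real_le_lsqrt) auto
      then show ?thesis using True by auto
    next
      case False
      then show ?thesis using E by (simp add: Z_def trunc_sq_def y_def)
    qed
    have y: "y \<le> 2 * d"
      using True imp d by (cases "k = 0") (force simp: y_def)+
    have "measure_pmf.prob M {E. real k \<le> Z E} \<le> measure_pmf.prob M {E. y \<le> \<bar>Y J E\<bar>}"
      using imp by (intro measure_pmf.finite_measure_mono) auto
    also have "\<dots> \<le> 2 * exp (- (y\<^sup>2 / (4 * d)))" by (rule tail[OF J y0 y])
    also have "y\<^sup>2 / (4 * d) = 2 * real k" using d by (simp add: y_def)
    finally show ?thesis by simp
  qed
  have half: "exp (- 1 :: real) \<le> 1 / 2"
    using exp_ge_add_one_self[of "1::real"] by (simp add: exp_minus field_simps)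
  have "measure_pmf.expectation M (\<lambda>E. exp (Z E))
      \<le> measure_pmf.expectation M (\<lambda>E. \<Sum>k\<le>K. exp (real k + 1) * indicator {E. real k \<le> Z E} E)"
    by (intro integral_mono integrable_measure_pmf_finite finite_M layer)
  also have "\<dots> = (\<Sum>k\<le>K. exp (real k + 1) * measure_pmf.prob M {E. real k \<le> Z E})"
    by (subst Bochner_Integration.integral_sum)
       (auto intro!: integrable_measure_pmf_finite finite_M)
  also have "\<dots> \<le> (\<Sum>k\<le>K. exp (real k + 1) * (2 * exp (- 2 * real k)))"
    by (intro sum_mono mult_left_mono prob_Z) auto
  also have "\<dots> = 2 * exp 1 * (\<Sum>k\<le>K. exp (- 1) ^ k)"
  proof -
    have "exp (real k + 1) * (2 * exp (- 2 * real k)) = 2 * exp 1 * exp (- 1) ^ k" for k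
    proof -
      have "exp (- 1 :: real) ^ k = exp (- real k)"
        using exp_of_nat_mult[of k "-1::real"] by simp
      then show ?thesis by (simp add: mult_exp_exp)
    qed
    then show ?thesis by (simp only: sum_distrib_left)
  qed
  also have "\<dots> \<le> 2 * exp 1 * (\<Sum>k\<le>K. (1 / 2) ^ k)"
    by (intro mult_left_mono sum_mono power_mono half) auto
  also have "\<dots> \<le> 2 * exp 1 * 2"
    by (intro mult_left_mono) (auto simp: sum_gp0)
  also have "\<dots> \<le> exp 1 * exp 2"
  proof -
    have "2 * 2 \<le> exp 1 * exp (1 :: real)"
      using exp_ge_add_one_self[of "1::real"] by (intro mult_mono) auto
    then have "4 \<le> exp (2 :: real)" by (simp add: mult_exp_exp)
    then have "exp 1 * 4 \<le> exp 1 * exp (2 :: real)" by (intro mult_left_mono) auto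
    then show ?thesis by simp
  qed
  also have "\<dots> = exp (3::real)" by (simp add: mult_exp_exp)
  finally show ?thesis by (simp add: Z_def)
qed

text \<open>Sums over disjoint blocks depend on disjoint groups of independent coordinates, so they
  are independent and the expectation factors.\<close>

lemma expectation_prod_blocks:
  fixes J :: "'i \<Rightarrow> 'e set"
  assumes fin: "finite L" and J: "\<And>v. v \<in> L \<Longrightarrow> J v \<subseteq> I" and disj: "disjoint_family_on J L"
    and g [measurable]: "g \<in> borel_measurable borel"
  shows "measure_pmf.expectation M (\<lambda>E. \<Prod>v\<in>L. g (Y (J v) E) :: real)
    = (\<Prod>v\<in>L. measure_pmf.expectation M (\<lambda>E. g (Y (J v) E)))"
proof -
  have "prob_space.indep_vars (measure_pmf M) (\<lambda>_. count_space UNIV) (\<lambda>e E. E e) I"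
    unfolding M_def by (rule indep_vars_Pi_pmf[OF finite_I])
  then have "prob_space.indep_vars (measure_pmf M) (\<lambda>_. borel) (\<lambda>e E. w e * (of_bool (E e) - \<pi> e)) I"
    by (rule prob_space.indep_vars_compose2[OF measure_pmf.prob_space_axioms]) auto
  then have "prob_space.indep_vars (measure_pmf M) (\<lambda>v. PiM (J v) (\<lambda>_. borel))
      (\<lambda>v E. \<lambda>e\<in>J v. w e * (of_bool (E e) - \<pi> e)) L"
    by (rule prob_space.indep_vars_restrict[OF measure_pmf.prob_space_axioms _ J disj])
  then have "prob_space.indep_vars (measure_pmf M) (\<lambda>_. borel)
      (\<lambda>v E. g (\<Sum>e\<in>J v. (\<lambda>e\<in>J v. w e * (of_bool (E e) - \<pi> e)) e)) L"
    by (rule prob_space.indep_vars_compose2[OF measure_pmf.prob_space_axioms, where Y = "\<lambda>v h. g (\<Sum>e\<in>J v. h e)"]) measurable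
  then have "prob_space.indep_vars (measure_pmf M) (\<lambda>_. borel) (\<lambda>v E. g (Y (J v) E)) L"
    by (simp add: Y_def cong: sum.cong)
  from prob_space.indep_vars_lebesgue_integral[OF measure_pmf.prob_space_axioms fin this] show ?thesis
    by (simp add: integrable_measure_pmf_finite finite_M)
qed

text \<open>Two failures are possible. Some block exceeds d / 4: a union bound over
  \<open>tail\<close>, with exponent (d / 4)^2 / (4 d) = d / 64. Or the truncated squares sum to at
  least 4 per block: by Markov and independence this costs exp (3 - 4) per block. Otherwise the
  truncation is inactive, and 4 times 8 d gives the constant 32.\<close>

lemma prob_blocks:
  fixes J :: "'i \<Rightarrow> 'e set"
  assumes fin: "finite L" and J: "\<And>v. v \<in> L \<Longrightarrow> J v \<subseteq> I" "\<And>v. v \<in> L \<Longrightarrow> sum \<pi> (J v) \<le> d"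
    and disj: "disjoint_family_on J L"
  shows "measure_pmf.prob M {E. \<not> ((\<forall>v\<in>L. \<bar>Y (J v) E\<bar> \<le> d / 4) \<and>
      (\<Sum>v\<in>L. (Y (J v) E)\<^sup>2) \<le> 32 * d * card L)}
    \<le> 2 * card L * exp (- (d / 64)) + exp (- real (card L))"
proof -
  define B where "B v = {E. d / 4 \<le> \<bar>Y (J v) E\<bar>}" for v
  define S where "S = {E. 4 * real (card L) \<le> (\<Sum>v\<in>L. trunc_sq (Y (J v) E))}"
  have "measure_pmf.prob M (B v) \<le> 2 * exp (- (d / 64))" if "v \<in> L" for v
  proof -
    have "(d / 4)\<^sup>2 / (4 * d) = d / 64" using d by (simp add: power2_eq_square)
    then show ?thesis
      using tail[OF J(1)[OF that] J(2)[OF that], of "d / 4"] d unfolding B_def \<open>(d / 4)\<^sup>2 / (4 * d) = d / 64\<close> by simp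
  qed
  then have B: "measure_pmf.prob M (\<Union>v\<in>L. B v) \<le> 2 * card L * exp (- (d / 64))"
    using measure_UNION_le[OF fin, of B "measure_pmf M"] sum_bounded_above[of L "\<lambda>v. measure_pmf.prob M (B v)"]
    by (fastforce simp: mult.commute mult.left_commute)
  have "measure_pmf.prob M S \<le> exp (- (4 * real (card L))) *
      measure_pmf.expectation M (\<lambda>E. exp (\<Sum>v\<in>L. trunc_sq (Y (J v) E)))"
    unfolding S_def by (rule pmf_markov_exp[OF finite_M])
  also have "measure_pmf.expectation M (\<lambda>E. exp (\<Sum>v\<in>L. trunc_sq (Y (J v) E)))
      = (\<Prod>v\<in>L. measure_pmf.expectation M (\<lambda>E. exp (trunc_sq (Y (J v) E))))"
    unfolding exp_sum[OF fin]
    by (rule expectation_prod_blocks[where g = "\<lambda>y. exp (trunc_sq y)"])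
       (use fin J disj in \<open>auto simp: trunc_sq_def[abs_def]\<close>)
  also have "\<dots> \<le> (\<Prod>v\<in>L. exp 3)"
    by (intro prod_mono conjI expectation_exp_trunc_sq J integral_nonneg_AE) auto
  also have "exp (- (4 * real (card L))) * (\<Prod>v\<in>L. exp 3) = exp (- real (card L))"
    by (simp add: exp_of_nat2_mult[symmetric] mult_exp_exp)
  finally have S: "measure_pmf.prob M S \<le> exp (- real (card L))" by simp
  have "{E. \<not> ((\<forall>v\<in>L. \<bar>Y (J v) E\<bar> \<le> d / 4) \<and> (\<Sum>v\<in>L. (Y (J v) E)\<^sup>2) \<le> 32 * d * card L)}
      \<subseteq> (\<Union>v\<in>L. B v) \<union> S"
  proof (intro subsetI, rule ccontr)
    fix E assume E: "E \<in> {E. \<not> ((\<forall>v\<in>L. \<bar>Y (J v) E\<bar> \<le> d / 4) \<and>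
      (\<Sum>v\<in>L. (Y (J v) E)\<^sup>2) \<le> 32 * d * card L)}" and nE: "E \<notin> (\<Union>v\<in>L. B v) \<union> S"
    have le: "\<bar>Y (J v) E\<bar> \<le> d / 4" if "v \<in> L" for v
      using nE that by (auto simp: B_def not_le intro: less_imp_le)
    have "(\<Sum>v\<in>L. trunc_sq (Y (J v) E)) = (\<Sum>v\<in>L. (Y (J v) E)\<^sup>2) / (8 * d)"
      using le by (simp add: trunc_sq_def sum_divide_distrib)
    moreover have "(\<Sum>v\<in>L. trunc_sq (Y (J v) E)) < 4 * real (card L)"
      using nE by (simp add: S_def)
    ultimately have "(\<Sum>v\<in>L. (Y (J v) E)\<^sup>2) \<le> 32 * d * card L"
      using d by (simp add: divide_less_eq mult.commute mult.left_commute)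
    then show False using E le by auto
  qed
  then have "measure_pmf.prob M {E. \<not> ((\<forall>v\<in>L. \<bar>Y (J v) E\<bar> \<le> d / 4) \<and>
      (\<Sum>v\<in>L. (Y (J v) E)\<^sup>2) \<le> 32 * d * card L)} \<le> measure_pmf.prob M ((\<Union>v\<in>L. B v) \<union> S)"
    by (intro measure_pmf.finite_measure_mono) auto
  also have "\<dots> \<le> measure_pmf.prob M (\<Union>v\<in>L. B v) + measure_pmf.prob M S"
    by (rule measure_Un_le) auto
  finally show ?thesis using B S by linarith
qed

end

section \<open>Propagation of the defect through the iteration\<close>

text \<open>Cauchy-Schwarz in each row, with the weight split into two square roots, bounds the
  weighted square of an average by the weighted sum of squares. Summing over rows and exchanging the
  sums turns column sums into degrees by symmetry.\<close>

lemma weighted_average_contraction: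
  fixes a :: "'v \<Rightarrow> 'v \<Rightarrow> real" and x :: "'v \<Rightarrow> real"
  assumes sym: "\<And>u v. u \<in> V \<Longrightarrow> v \<in> V \<Longrightarrow> a u v = a v u"
    and nonneg: "\<And>u v. u \<in> V \<Longrightarrow> v \<in> V \<Longrightarrow> 0 \<le> a u v"
    and deg: "\<And>v. v \<in> V \<Longrightarrow> 0 < (\<Sum>u\<in>V. a v u)"
  shows "L2_set (\<lambda>v. sqrt (\<Sum>u\<in>V. a v u) * ((\<Sum>u\<in>V. a v u * x u) / (\<Sum>u\<in>V. a v u))) V
    \<le> L2_set (\<lambda>v. sqrt (\<Sum>u\<in>V. a v u) * x v) V"
  unfolding L2_set_def
proof (rule real_sqrt_le_mono)
  have "(sqrt (\<Sum>u\<in>V. a v u) * ((\<Sum>u\<in>V. a v u * x u) / (\<Sum>u\<in>V. a v u)))\<^sup>2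
      \<le> (\<Sum>u\<in>V. a v u * (x u)\<^sup>2)" if v: "v \<in> V" for v
  proof -
    have "(\<Sum>u\<in>V. a v u * x u)\<^sup>2 = (\<Sum>u\<in>V. sqrt (a v u) * (sqrt (a v u) * x u))\<^sup>2"
      using nonneg[OF v] by (intro arg_cong[where f = "\<lambda>z. z\<^sup>2"] sum.cong) (auto simp flip: mult.assoc)
    also have "\<dots> \<le> (\<Sum>u\<in>V. (sqrt (a v u))\<^sup>2) * (\<Sum>u\<in>V. (sqrt (a v u) * x u)\<^sup>2)"
      by (rule Cauchy_Schwarz_ineq_sum)
    also have "\<dots> = (\<Sum>u\<in>V. a v u) * (\<Sum>u\<in>V. a v u * (x u)\<^sup>2)"
      using nonneg[OF v] by (simp add: power_mult_distrib)
    finally have "(\<Sum>u\<in>V. a v u * x u)\<^sup>2 / (\<Sum>u\<in>V. a v u) \<le> (\<Sum>u\<in>V. a v u * (x u)\<^sup>2)"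
      using deg[OF v] by (simp add: divide_le_eq mult.commute)
    then show ?thesis
      using deg[OF v] by (simp add: power_mult_distrib power_divide) (simp add: power2_eq_square)
  qed
  then have "(\<Sum>v\<in>V. (sqrt (\<Sum>u\<in>V. a v u) * ((\<Sum>u\<in>V. a v u * x u) / (\<Sum>u\<in>V. a v u)))\<^sup>2)
      \<le> (\<Sum>v\<in>V. \<Sum>u\<in>V. a v u * (x u)\<^sup>2)" by (rule sum_mono)
  also have "\<dots> = (\<Sum>u\<in>V. \<Sum>v\<in>V. a v u * (x u)\<^sup>2)" by (rule sum.swap)
  also have "\<dots> = (\<Sum>u\<in>V. (\<Sum>v\<in>V. a u v) * (x u)\<^sup>2)"
    unfolding sum_distrib_right by (intro sum.cong refl) (simp add: sym)
  also have "\<dots> = (\<Sum>v\<in>V. (sqrt (\<Sum>u\<in>V. a v u) * x v)\<^sup>2)"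
    using deg by (intro sum.cong) (auto simp: power_mult_distrib less_imp_le)
  finally show "(\<Sum>v\<in>V. (sqrt (\<Sum>u\<in>V. a v u) * ((\<Sum>u\<in>V. a v u * x u) / (\<Sum>u\<in>V. a v u)))\<^sup>2)
      \<le> (\<Sum>v\<in>V. (sqrt (\<Sum>u\<in>V. a v u) * x v)\<^sup>2)" .
qed

lemma dim_appnp:
  assumes "A \<in> carrier_mat N N" "X \<in> carrier_vec N"
  shows "dim_vec (appnp \<alpha> A X n) = N"
  using assms by (induction n) (auto simp: walk_mat_def)

lemma appnp_Suc_index:
  assumes A: "A \<in> carrier_mat N N" and X: "X \<in> carrier_vec N" and v: "v < N"
  shows "appnp \<alpha> A X (Suc n) $ v =
    (1 - \<alpha>) * ((\<Sum>u<N. A $$ (v, u) * appnp \<alpha> A X n $ u) / (\<Sum>u<N. A $$ (v, u))) + \<alpha> * X $ v"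
proof -
  have W: "walk_mat A $$ (v, u) = A $$ (v, u) / node_degree A v" if "u < N" for u
    using A v that unfolding walk_mat_def by (simp add: mat_diag_mult_left[OF A])
  have "(walk_mat A *\<^sub>v appnp \<alpha> A X n) $ v = (\<Sum>u<N. walk_mat A $$ (v, u) * appnp \<alpha> A X n $ u)"
    using walk_mat_carrier[OF A] v dim_appnp[OF A X, of \<alpha> n]
    by (auto simp: scalar_prod_def lessThan_atLeast0 intro!: sum.cong)
  also have "\<dots> = (\<Sum>u<N. A $$ (v, u) * appnp \<alpha> A X n $ u) / (\<Sum>u<N. A $$ (v, u))"
    using A by (simp add: W node_degree_def sum_divide_distrib)
  finally show ?thesis
    using walk_mat_carrier[OF A] X v by simp
qed

text \<open>Negative on \<open>C1\<close>, so that pairing with it yields the \<open>C2\<close> sum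
  minus the \<open>C1\<close> sum, the orientation of the gap. The class means are a constant plus a
  multiple of this vector.\<close>

definition class_sign :: "nat set \<Rightarrow> nat \<Rightarrow> real" where
  "class_sign C1 v = (if v \<in> C1 then - 1 else 1)"

lemma balanced_classes_sum:
  assumes "balanced_classes N C1 C2"
  shows "(\<Sum>v<N. f v) = (\<Sum>v\<in>C1. f v) + (\<Sum>v\<in>C2. f v :: real)"
proof -
  have C: "C1 \<union> C2 = {..<N}" "C1 \<inter> C2 = {}" using assms by (auto simp: balanced_classes_def)
  then have "finite C1" "finite C2" by (metis finite_Un finite_lessThan)+
  then show ?thesis unfolding C(1)[symmetric] using C(2) by (intro sum.union_disjoint)
qed

lemma sum_class_sign_mult:
  assumes "balanced_classes N C1 C2"
  shows "(\<Sum>v<N. class_sign C1 v * f v) = (\<Sum>v\<in>C2. f v) - (\<Sum>v\<in>C1. f v)"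
proof -
  have "v \<notin> C1" if "v \<in> C2" for v using assms that by (auto simp: balanced_classes_def)
  then show ?thesis
    unfolding balanced_classes_sum[OF assms] by (simp add: class_sign_def sum_negf cong: sum.cong)
qed

text \<open>Purely deterministic. Averaging fixes constants and multiplies the class sign by
  \<Lambda> up to a defect, so without defect the sign component would follow the recursion of
  \<open>c\<close>. Each step adds at most one multiple of the defect norm, hence the factor
  \<open>n\<close>. The lower degree bound converts between weighted and unweighted norms.\<close>

lemma appnp_class_gap_bound:
  fixes A :: "real mat"
  assumes A: "A \<in> carrier_mat N N" and N: "N > 0"
    and sym: "\<And>u v. u < N \<Longrightarrow> v < N \<Longrightarrow> A $$ (u, v) = A $$ (v, u)"
    and nonneg: "\<And>u v. u < N \<Longrightarrow> v < N \<Longrightarrow> 0 \<le> A $$ (u, v)"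
    and C: "balanced_classes N C1 C2"
    and d: "d > 0" and deg: "\<And>v. v < N \<Longrightarrow> d / 2 \<le> (\<Sum>u<N. A $$ (v, u))"
    and \<alpha>: "0 < \<alpha>" "\<alpha> < 1" and \<Lambda>: "0 \<le> \<Lambda>" "\<Lambda> \<le> 1" and \<mu>: "\<mu>1 \<le> \<mu>2"
    and B: "(\<Sum>v<N. ((\<Sum>u<N. A $$ (v, u) * class_sign C1 u)
        - \<Lambda> * class_sign C1 v * (\<Sum>u<N. A $$ (v, u)))\<^sup>2) \<le> B\<^sup>2 * d * N" and B0: "B \<ge> 0"
    and c: "c 0 = 1" "\<And>n. c (Suc n) = (1 - \<alpha>) * \<Lambda> * c n + \<alpha>"
  shows "\<bar>appnp_class_mean \<alpha> n A C2 (class_value C1 \<mu>1 \<mu>2)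
      - appnp_class_mean \<alpha> n A C1 (class_value C1 \<mu>1 \<mu>2) - c n * (\<mu>2 - \<mu>1)\<bar>
    \<le> 2 * real n * B * (\<mu>2 - \<mu>1) / sqrt d"
proof -
  define X where "X = vec N (class_value C1 \<mu>1 \<mu>2)"
  define h where "h n v = appnp \<alpha> A X n $ v" for n v
  define s where "s = class_sign C1"
  define D where "D v = (\<Sum>u<N. A $$ (v, u))" for v
  define P where "P x v = (\<Sum>u<N. A $$ (v, u) * x u) / D v" for x v
  define m where "m = (\<mu>1 + \<mu>2) / 2"
  define \<Delta> where "\<Delta> = \<mu>2 - \<mu>1"
  define e where "e v = P s v - \<Lambda> * s v" for v
  \<comment> \<open>\<open>g n\<close> is the deviation of \<open>h n\<close> from the mean-field iterate; it is driven by the defect \<open>e\<close>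
    of \<open>s\<close> being an eigenvector of \<open>P\<close>, and \<open>P\<close> is a contraction in the norm \<open>nrm\<close>.\<close>
  define g where "g n v = h n v - m - \<Delta> / 2 * c n * s v" for n v
  define nrm where "nrm x = L2_set (\<lambda>v. sqrt (D v) * x v) {..<N}" for x
  have D0: "0 < D v" "d / 2 \<le> D v" if "v < N" for v using deg[OF that] d by (auto simp: D_def)
  have \<Delta>: "\<Delta> \<ge> 0" using \<mu> by (simp add: \<Delta>_def)
  have X: "X \<in> carrier_vec N" by (simp add: X_def)
  have Xv: "X $ v = m + \<Delta> / 2 * s v" if "v < N" for v
    using that by (auto simp: X_def class_value_def m_def \<Delta>_def s_def class_sign_def field_simps)
  \<comment> \<open>Keeps the defect injected at each step from growing with
    \<open>n\<close>.\<close>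
  have c01: "0 \<le> c n \<and> c n \<le> 1" for n
  proof (induction n)
    case (Suc n)
    have "(1 - \<alpha>) * (\<Lambda> * c n) \<le> (1 - \<alpha>) * 1"
      using Suc \<alpha> \<Lambda> by (intro mult_left_mono mult_le_one) auto
    then have "(1 - \<alpha>) * \<Lambda> * c n + \<alpha> \<le> 1" by (simp add: mult.assoc)
    then show ?case using c(2)[of n] \<alpha> \<Lambda> Suc by simp
  qed (simp add: c)
  have P_nrm: "nrm (P x) \<le> nrm x" for x
    unfolding nrm_def P_def D_def
    by (rule weighted_average_contraction) (use sym nonneg D0 in \<open>auto simp: D_def\<close>)
  have P_lin: "P (\<lambda>v. a + b * x v + y v) v = a + b * P x v + P y v" if "v < N" for a b x y v
  proof -
    have "(\<Sum>u<N. A $$ (v, u) * (a + b * x u + y u)) =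
        a * D v + b * (\<Sum>u<N. A $$ (v, u) * x u) + (\<Sum>u<N. A $$ (v, u) * y u)"
      by (simp add: D_def sum_distrib_left sum.distrib algebra_simps)
    then show ?thesis using D0[OF that] by (simp add: P_def add_divide_distrib)
  qed
  have h_eq: "h n = (\<lambda>v. m + \<Delta> / 2 * c n * s v + g n v)" for n
    by (rule ext) (simp add: g_def)
  have g_Suc: "g (Suc n) v = (1 - \<alpha>) * (P (g n) v + \<Delta> / 2 * c n * e v)" if v: "v < N" for n v
  proof -
    have "h (Suc n) v = (1 - \<alpha>) * P (h n) v + \<alpha> * (m + \<Delta> / 2 * s v)"
      unfolding h_def P_def D_def appnp_Suc_index[OF A X v] Xv[OF v] ..
    also have "P (h n) v = m + \<Delta> / 2 * c n * P s v + P (g n) v"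
      by (subst h_eq) (rule P_lin[OF v])
    finally show ?thesis by (simp add: g_def e_def c(2) field_simps)
  qed
  have nrm_g: "nrm (g n) \<le> n * (\<Delta> / 2 * nrm e)" for n
  proof (induction n)
    case 0
    have "g 0 v = 0" if "v < N" for v using that by (simp add: g_def h_def c Xv)
    then have "nrm (g 0) = L2_set (\<lambda>v. 0) {..<N}"
      unfolding nrm_def by (intro L2_set_cong) auto
    then show ?case by (simp add: L2_set_def)
  next
    case (Suc n)
    have "nrm (g (Suc n)) = L2_set (\<lambda>v. (1 - \<alpha>) * (sqrt (D v) * P (g n) v
        + \<Delta> / 2 * c n * (sqrt (D v) * e v))) {..<N}"
      unfolding nrm_def by (intro L2_set_cong) (auto simp: g_Suc algebra_simps)
    also have "\<dots> = (1 - \<alpha>) * L2_set (\<lambda>v. sqrt (D v) * P (g n) v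
        + \<Delta> / 2 * c n * (sqrt (D v) * e v)) {..<N}"
      using \<alpha> by (subst L2_set_right_distrib) auto
    also have "\<dots> \<le> 1 * L2_set (\<lambda>v. sqrt (D v) * P (g n) v
        + \<Delta> / 2 * c n * (sqrt (D v) * e v)) {..<N}"
      using \<alpha> by (intro mult_right_mono L2_set_nonneg) auto
    also have "\<dots> \<le> nrm (P (g n)) + L2_set (\<lambda>v. \<Delta> / 2 * c n * (sqrt (D v) * e v)) {..<N}"
      unfolding nrm_def by (simp add: L2_set_triangle_ineq)
    also have "L2_set (\<lambda>v. \<Delta> / 2 * c n * (sqrt (D v) * e v)) {..<N} = \<Delta> / 2 * c n * nrm e"
      unfolding nrm_def using \<Delta> c01[of n] by (subst L2_set_right_distrib) auto
    also have "\<dots> \<le> \<Delta> / 2 * 1 * nrm e"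
      using \<Delta> c01[of n] unfolding nrm_def by (intro mult_mono L2_set_nonneg) auto
    also have "nrm (P (g n)) \<le> n * (\<Delta> / 2 * nrm e)" using P_nrm Suc by (rule order_trans)
    finally show ?case by (simp add: algebra_simps)
  qed
  have nrm_e: "nrm e \<le> sqrt (2 * N) * B"
  proof -
    \<comment> \<open>The defect is a row sum divided by the degree; the weight restores half a
      power, leaving 1 / \<open>D v\<close>, which is at most 2 / d.\<close>
    have "(sqrt (D v) * e v)\<^sup>2 \<le> 2 / d * ((\<Sum>u<N. A $$ (v, u) * s u) - \<Lambda> * s v * D v)\<^sup>2"
      if v: "v < N" for v
    proof -
      have "e v = ((\<Sum>u<N. A $$ (v, u) * s u) - \<Lambda> * s v * D v) / D v"
        using D0[OF v] by (simp add: e_def P_def diff_divide_distrib)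
      then have "(sqrt (D v) * e v)\<^sup>2 = 1 / D v * ((\<Sum>u<N. A $$ (v, u) * s u) - \<Lambda> * s v * D v)\<^sup>2"
        using D0[OF v] by (simp add: power_mult_distrib power_divide) (simp add: power2_eq_square)
      also have "\<dots> \<le> 2 / d * ((\<Sum>u<N. A $$ (v, u) * s u) - \<Lambda> * s v * D v)\<^sup>2"
        using D0[OF v] d by (intro mult_right_mono) (auto simp: field_simps)
      finally show ?thesis .
    qed
    then have "(\<Sum>v<N. (sqrt (D v) * e v)\<^sup>2)
        \<le> (\<Sum>v<N. 2 / d * ((\<Sum>u<N. A $$ (v, u) * s u) - \<Lambda> * s v * D v)\<^sup>2)"
      by (intro sum_mono) auto
    also have "\<dots> \<le> 2 / d * (B\<^sup>2 * d * N)"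
      unfolding sum_distrib_left[symmetric] using d B by (intro mult_left_mono) (auto simp: s_def D_def)
    also have "\<dots> = (sqrt (2 * N) * B)\<^sup>2" using d by (simp add: power_mult_distrib)
    finally show ?thesis
      unfolding nrm_def L2_set_def using B0 by (intro real_le_lsqrt) auto
  qed
  have abs_s: "\<bar>s v\<bar> = 1" "s v * s v = 1" for v by (auto simp: s_def class_sign_def)
  have sum_s: "(\<Sum>v<N. s v) = 0"
    using sum_class_sign_mult[OF C, of "\<lambda>_. 1"] C by (simp add: s_def balanced_classes_def)
  have "\<bar>\<Sum>v<N. s v * g n v\<bar> \<le> (\<Sum>v<N. \<bar>1\<bar> * \<bar>g n v\<bar>)"
    by (rule order_trans[OF sum_abs]) (simp add: abs_mult abs_s)
  also have "\<dots> \<le> L2_set (\<lambda>_. 1) {..<N} * L2_set (g n) {..<N}"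
    by (rule L2_set_mult_ineq)
  also have "L2_set (g n) {..<N} \<le> L2_set (\<lambda>v. sqrt (2 / d) * (sqrt (D v) * g n v)) {..<N}"
    unfolding L2_set_def
  proof (intro real_sqrt_le_mono sum_mono)
    fix v assume v: "v \<in> {..<N}"
    have "1 \<le> 2 / d * D v" using D0[of v] v d by (simp add: field_simps)
    then have "1 * (g n v)\<^sup>2 \<le> 2 / d * D v * (g n v)\<^sup>2" by (intro mult_right_mono) auto
    then show "(g n v)\<^sup>2 \<le> (sqrt (2 / d) * (sqrt (D v) * g n v))\<^sup>2"
      using D0[of v] v d by (simp add: power_mult_distrib)
  qed
  also have "\<dots> = sqrt (2 / d) * nrm (g n)"
    unfolding nrm_def using d by (subst L2_set_right_distrib) auto
  also have "\<dots> \<le> sqrt (2 / d) * (n * (\<Delta> / 2 * (sqrt (2 * N) * B)))"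
    using d \<Delta> by (intro mult_left_mono order_trans[OF nrm_g] nrm_e) auto
  also have "L2_set (\<lambda>_. 1) {..<N} * \<dots> = real N * (n * B * \<Delta> / sqrt d)"
  proof -
    \<comment> \<open>The factors come from the norm of the constant 1, the change of norm and the
      defect. Their product is linear in N, which the normalisation 2 / N of the class means
      cancels.\<close>
    have "sqrt N * sqrt (2 / d) * sqrt (2 * N) = 2 * real N / sqrt d"
    proof -
      have "sqrt (2 * N) = sqrt 2 * sqrt N" by (simp add: real_sqrt_mult)
      moreover have "sqrt N * (sqrt 2 / sqrt d) * (sqrt 2 * sqrt N)
          = (sqrt 2 * sqrt 2) * (sqrt N * sqrt N) / sqrt d" by (simp only: mult_ac times_divide_eq_right times_divide_eq_left)
      ultimately show ?thesis unfolding real_sqrt_divide by simp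
    qed
    then have "sqrt N * sqrt (2 / d) * sqrt (2 * N) * (n * B * \<Delta> / 2)
        = 2 * real N / sqrt d * (n * B * \<Delta> / 2)" by simp
    then show ?thesis by (simp add: L2_set_def mult_ac)
  qed
  finally have sg: "\<bar>\<Sum>v<N. s v * g n v\<bar> \<le> real N * (n * B * \<Delta> / sqrt d)"
    by (simp add: L2_set_def mult_left_mono)
  have mean: "appnp_class_mean \<alpha> n A C' (class_value C1 \<mu>1 \<mu>2) = 2 / N * (\<Sum>v\<in>C'. h n v)" for C'
    unfolding appnp_class_mean_def h_def using A
    by (simp add: appnp_eq_appnp_mat[OF A X, unfolded X_def] X_def)
  have "appnp_class_mean \<alpha> n A C2 (class_value C1 \<mu>1 \<mu>2)
      - appnp_class_mean \<alpha> n A C1 (class_value C1 \<mu>1 \<mu>2) = 2 / N * (\<Sum>v<N. s v * h n v)"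
    unfolding mean s_def sum_class_sign_mult[OF C] by (simp add: right_diff_distrib)
  \<comment> \<open>The common level \<open>m\<close> drops out because the classes are
    balanced.\<close>
  also have "(\<Sum>v<N. s v * h n v) = m * (\<Sum>v<N. s v) + \<Delta> / 2 * c n * (\<Sum>v<N. s v * s v)
      + (\<Sum>v<N. s v * g n v)"
    by (simp add: h_eq sum_distrib_left sum.distrib algebra_simps)
  also have "2 / N * \<dots> = c n * \<Delta> + 2 / N * (\<Sum>v<N. s v * g n v)"
    using N by (simp add: sum_s abs_s field_simps)
  finally have "\<bar>appnp_class_mean \<alpha> n A C2 (class_value C1 \<mu>1 \<mu>2)
      - appnp_class_mean \<alpha> n A C1 (class_value C1 \<mu>1 \<mu>2) - c n * (\<mu>2 - \<mu>1)\<bar>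
    = 2 / N * \<bar>\<Sum>v<N. s v * g n v\<bar>"
    by (simp add: \<Delta>_def abs_mult)
  also have "\<dots> \<le> 2 / N * (real N * (n * B * \<Delta> / sqrt d))"
    by (intro mult_left_mono sg) auto
  also have "\<dots> = 2 * real n * B * (\<mu>2 - \<mu>1) / sqrt d" using N by (simp add: \<Delta>_def)
  finally show ?thesis .
qed

section \<open>Row sums of the random adjacency matrix\<close>

definition edge_prob :: "nat set \<Rightarrow> real \<Rightarrow> real \<Rightarrow> nat \<Rightarrow> nat \<Rightarrow> real" where
  "edge_prob C1 p q u v = (if u \<in> C1 \<longleftrightarrow> v \<in> C1 then p else q)"

lemma edge_prob_commute: "edge_prob C1 p q u v = edge_prob C1 p q v u"
  by (auto simp: edge_prob_def)

text \<open>Constants and the class sign are eigenvectors of the expected adjacency matrix. The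
  quotient of their eigenvalues is the damping factor (p - q) / (p + q).\<close>

lemma sum_edge_prob:
  assumes "balanced_classes N C1 C2" "v < N"
  shows "(\<Sum>u<N. edge_prob C1 p q v u) = real N * (p + q) / 2"
    and "(\<Sum>u<N. edge_prob C1 p q v u * class_sign C1 u) = real N * (p - q) / 2 * class_sign C1 v"
proof -
  have C: "u \<notin> C1" if "u \<in> C2" for u using assms that by (auto simp: balanced_classes_def)
  have card: "real (card C1) = real N / 2" "real (card C2) = real N / 2"
    using assms by (auto simp: balanced_classes_def)
  have "edge_prob C1 p q v u = (if v \<in> C1 then p else q)" if "u \<in> C1" for u
    using that by (simp add: edge_prob_def)
  moreover have "edge_prob C1 p q v u = (if v \<in> C1 then q else p)" if "u \<in> C2" for u
    using C that by (simp add: edge_prob_def)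
  ultimately show "(\<Sum>u<N. edge_prob C1 p q v u) = real N * (p + q) / 2"
    "(\<Sum>u<N. edge_prob C1 p q v u * class_sign C1 u) = real N * (p - q) / 2 * class_sign C1 v"
    unfolding balanced_classes_sum[OF assms(1)]
    using C by (auto simp: card class_sign_def field_simps cong: sum.cong)
qed

text \<open>Splitting a row of the symmetric matrix at the diagonal makes the rows of each
  part depend on disjoint sets of edges, hence independent.\<close>

lemma prob_centered_rows:
  fixes w :: "nat \<Rightarrow> nat \<Rightarrow> real"
  assumes C: "balanced_classes N C1 C2" and N: "N > 0" and pq: "0 \<le> q" "q \<le> 1" "0 < p" "p \<le> 1"
    and w: "\<And>u v. \<bar>w u v\<bar> \<le> 1"
  defines "d \<equiv> real N * (p + q) / 2"
    and "x \<equiv> \<lambda>v E. \<Sum>u<N. w v u * (of_bool (E (min v u, max v u)) - edge_prob C1 p q v u)"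
  shows "measure_pmf.prob (edge_pmf N C1 p q)
      {E. \<not> ((\<forall>v<N. \<bar>x v E\<bar> \<le> d / 2) \<and> (\<Sum>v<N. (x v E)\<^sup>2) \<le> 128 * d * N)}
    \<le> 4 * real N * exp (- (d / 64)) + 2 * exp (- real N)"
proof -
  define I where "I = {(u, v). u \<le> v \<and> v < N}"
  define \<pi> where "\<pi> = (\<lambda>(u, v). edge_prob C1 p q u v)"
  have "I \<subseteq> {..<N} \<times> {..<N}" by (auto simp: I_def)
  then have fin: "finite I" by (rule finite_subset) auto
  have \<pi>: "0 \<le> \<pi> e \<and> \<pi> e \<le> 1" for e
    using pq by (auto simp: \<pi>_def edge_prob_def split: prod.split)
  have d: "d > 0" unfolding d_def using N pq by (intro divide_pos_pos mult_pos_pos) auto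
  interpret U: bernoulli_field I \<pi> "\<lambda>(u, v). w u v" d
    by unfold_locales (use fin \<pi> w d in \<open>auto split: prod.split\<close>)
  interpret L: bernoulli_field I \<pi> "\<lambda>(u, v). w v u" d
    by unfold_locales (use fin \<pi> w d in \<open>auto split: prod.split\<close>)
  \<comment> \<open>The law does not involve the weights, so both interpretations share it:
    \<open>U\<close> weighs an edge as seen from its smaller endpoint, \<open>L\<close> as seen from
    its larger one.\<close>
  have M: "edge_pmf N C1 p q = U.M"
    unfolding U.M_def unfolding edge_pmf_def I_def \<pi>_def edge_prob_def
    by (auto intro!: arg_cong[where f = "Pi_pmf _ _"])
  \<comment> \<open>\<open>J v\<close> holds the edges of row v from the diagonal onwards,
    \<open>K v\<close> those strictly before it.\<close>
  define J where "J v = {v} \<times> {v..<N}" for v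
  define K where "K v = {..<v} \<times> {v}" for v :: nat
  have part: "{..<N} = {..<v} \<union> {v..<N}" if "v < N" for v using that by auto
  have row: "(\<Sum>u<v. f u) + (\<Sum>u\<in>{v..<N}. f u) = (\<Sum>u<N. f u)" if "v < N" for v and f :: "nat \<Rightarrow> real"
    unfolding part[OF that] by (subst sum.union_disjoint) auto
  have sumJ: "sum \<pi> (J v) = (\<Sum>u\<in>{v..<N}. edge_prob C1 p q v u)" for v
    unfolding J_def \<pi>_def sum.cartesian_product[symmetric] by simp
  have sumK: "sum \<pi> (K v) = (\<Sum>u<v. edge_prob C1 p q v u)" for v
    unfolding K_def \<pi>_def sum.cartesian_product[symmetric] by (simp add: edge_prob_commute)
  have sum_le: "sum \<pi> (J v) \<le> d" "sum \<pi> (K v) \<le> d" if "v < N" for v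
  proof -
    have "sum \<pi> (K v) + sum \<pi> (J v) = d"
      unfolding sumJ sumK row[OF that] sum_edge_prob(1)[OF C that] d_def ..
    moreover have "0 \<le> sum \<pi> (J v)" "0 \<le> sum \<pi> (K v)" using \<pi> by (auto intro!: sum_nonneg)
    ultimately show "sum \<pi> (J v) \<le> d" "sum \<pi> (K v) \<le> d" by linarith+
  qed
  have x_eq: "x v E = L.Y (K v) E + U.Y (J v) E" if v: "v < N" for v E
  proof -
    have "L.Y (K v) E = (\<Sum>u<v. w v u * (of_bool (E (min v u, max v u)) - edge_prob C1 p q v u))"
      unfolding L.Y_def unfolding K_def \<pi>_def sum.cartesian_product'
      by (auto simp: edge_prob_commute[of _ _ _ v] min_def max_def intro!: sum.cong)
    moreover have "U.Y (J v) E
        = (\<Sum>u\<in>{v..<N}. w v u * (of_bool (E (min v u, max v u)) - edge_prob C1 p q v u))"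
      unfolding U.Y_def unfolding J_def \<pi>_def sum.cartesian_product'
      by (auto simp: min_def max_def intro!: sum.cong)
    ultimately show ?thesis unfolding x_def by (simp only: row[OF v])
  qed
  define BU where "BU = {E. \<not> ((\<forall>v\<in>{..<N}. \<bar>U.Y (J v) E\<bar> \<le> d / 4) \<and>
      (\<Sum>v\<in>{..<N}. (U.Y (J v) E)\<^sup>2) \<le> 32 * d * card {..<N})}"
  define BL where "BL = {E. \<not> ((\<forall>v\<in>{..<N}. \<bar>L.Y (K v) E\<bar> \<le> d / 4) \<and>
      (\<Sum>v\<in>{..<N}. (L.Y (K v) E)\<^sup>2) \<le> 32 * d * card {..<N})}"
  have "measure_pmf.prob (edge_pmf N C1 p q) BU
      \<le> 2 * card {..<N} * exp (- (d / 64)) + exp (- real (card {..<N}))"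
    unfolding BU_def M
    by (rule U.prob_blocks) (use sum_le in \<open>auto simp: J_def I_def disjoint_family_on_def\<close>)
  moreover have "measure_pmf.prob (edge_pmf N C1 p q) BL
      \<le> 2 * card {..<N} * exp (- (d / 64)) + exp (- real (card {..<N}))"
    unfolding BL_def M
    by (rule L.prob_blocks) (use sum_le in \<open>auto simp: K_def I_def disjoint_family_on_def\<close>)
  moreover have "{E. \<not> ((\<forall>v<N. \<bar>x v E\<bar> \<le> d / 2) \<and> (\<Sum>v<N. (x v E)\<^sup>2) \<le> 128 * d * N)} \<subseteq> BU \<union> BL"
  proof (intro subsetI, rule ccontr)
    fix E
    assume E: "E \<in> {E. \<not> ((\<forall>v<N. \<bar>x v E\<bar> \<le> d / 2) \<and> (\<Sum>v<N. (x v E)\<^sup>2) \<le> 128 * d * N)}"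
      and "E \<notin> BU \<union> BL"
    then have U: "\<bar>U.Y (J v) E\<bar> \<le> d / 4" and L: "\<bar>L.Y (K v) E\<bar> \<le> d / 4" if "v < N" for v
      using that by (auto simp: BU_def BL_def)
    have U2: "(\<Sum>v<N. (U.Y (J v) E)\<^sup>2) \<le> 32 * d * N" and L2: "(\<Sum>v<N. (L.Y (K v) E)\<^sup>2) \<le> 32 * d * N"
      using \<open>E \<notin> BU \<union> BL\<close> by (auto simp: BU_def BL_def)
    have "\<bar>x v E\<bar> \<le> d / 2" if "v < N" for v
      using U[OF that] L[OF that] unfolding x_eq[OF that] by linarith
    \<comment> \<open>By (a + b)^2 \<le> 2 a^2 + 2 b^2, the constant is 2 * 32 + 2 * 32 =
      128.\<close>
    moreover have "(\<Sum>v<N. (x v E)\<^sup>2) \<le> (\<Sum>v<N. 2 * (L.Y (K v) E)\<^sup>2 + 2 * (U.Y (J v) E)\<^sup>2)"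
    proof (rule sum_mono)
      fix v assume "v \<in> {..<N}"
      then show "(x v E)\<^sup>2 \<le> 2 * (L.Y (K v) E)\<^sup>2 + 2 * (U.Y (J v) E)\<^sup>2"
        using sum_squares_bound[of "L.Y (K v) E" "U.Y (J v) E"] by (simp add: x_eq power2_sum)
    qed
    then have "(\<Sum>v<N. (x v E)\<^sup>2) \<le> 128 * d * N"
      using U2 L2 by (simp add: sum.distrib flip: sum_distrib_left)
    ultimately show False using E by blast
  qed
  then have "measure_pmf.prob (edge_pmf N C1 p q)
      {E. \<not> ((\<forall>v<N. \<bar>x v E\<bar> \<le> d / 2) \<and> (\<Sum>v<N. (x v E)\<^sup>2) \<le> 128 * d * N)}
      \<le> measure_pmf.prob (edge_pmf N C1 p q) BU + measure_pmf.prob (edge_pmf N C1 p q) BL"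
    by (intro order_trans[OF measure_pmf.finite_measure_mono measure_Un_le]) auto
  ultimately show ?thesis by (simp add: algebra_simps)
qed

section \<open>The gap of the random graph\<close>

lemma adj_mat_carrier: "adj_mat N E \<in> carrier_mat N N"
  by (simp add: adj_mat_def)

lemma adj_mat_index:
  "u < N \<Longrightarrow> v < N \<Longrightarrow> adj_mat N E $$ (u, v) = of_bool (E (min u v, max u v))"
  by (simp add: adj_mat_def)

text \<open>The first summand is the fixed point of the affine recursion; the second is the
  deviation of the initial value 1 from it, which shrinks geometrically.\<close>

lemma appnp_coefficient_Suc:
  fixes a p q :: real
  assumes a: "0 < a" "a < 1" and pq: "0 < q" "0 < p"
  defines "c \<equiv> \<lambda>n. (p + q) / (p + (2 - a) / a * q)
      + (2 - 2 * a) * q / (a * p + (2 - a) * q) * (1 - a) ^ n * ((p - q) / (p + q)) ^ n"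
  shows "c 0 = 1" "c (Suc n) = (1 - a) * ((p - q) / (p + q)) * c n + a"
proof -
  define D where "D = a * p + (2 - a) * q"
  have D: "D > 0" unfolding D_def using a pq by (intro add_pos_pos mult_pos_pos) auto
  have first: "(p + q) / (p + (2 - a) / a * q) = a * (p + q) / D"
    using a D by (simp add: D_def field_simps)
  have s: "p + q > 0" using pq by simp
  have c_eq: "c n = a * (p + q) / D + (2 - 2 * a) * q / D * ((1 - a) * ((p - q) / (p + q))) ^ n" for n
    unfolding c_def first D_def[symmetric] by (simp only: power_mult_distrib mult.assoc)
  have "a * (p + q) + (2 - 2 * a) * q = D" by (simp add: D_def algebra_simps)
  then show "c 0 = 1" using D by (simp add: c_eq flip: add_divide_distrib)
  have "a * (p + q) / D = (1 - a) * ((p - q) / (p + q)) * (a * (p + q) / D) + a"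
  proof -
    have "(1 - a) * (p - q) + D = p + q" by (simp add: D_def algebra_simps)
    moreover have "(1 - a) * ((p - q) / (p + q)) * (a * (p + q) / D) + a
        = a * ((1 - a) * (p - q) + D) / D"
    proof -
      have "(p - q) / (p + q) * (a * (p + q) / D) = a * (p - q) / D" using s by simp
      then have "(1 - a) * ((p - q) / (p + q)) * (a * (p + q) / D) + a = (1 - a) * (a * (p - q) / D) + a"
        by (simp only: mult.assoc)
      also have "\<dots> = a * ((1 - a) * (p - q) + D) / D"
        using D by (simp add: field_simps)
      finally show ?thesis .
    qed
    ultimately show ?thesis by simp
  qed
  moreover have "K + R * (b * y) = b * (K + R * y) + a" if "K = b * K + a" for K R b y :: real
  proof -
    have "b * (K + R * y) + a = (b * K + a) + R * (b * y)" by (simp add: algebra_simps)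
    then show ?thesis using that by linarith
  qed
  ultimately show "c (Suc n) = (1 - a) * ((p - q) / (p + q)) * c n + a"
    unfolding c_eq power_Suc by blast
qed

definition gap_event :: "real \<Rightarrow> nat \<Rightarrow> real \<Rightarrow> real \<Rightarrow> nat \<Rightarrow> nat set \<Rightarrow> nat set \<Rightarrow>
    real \<Rightarrow> real \<Rightarrow> real mat set" where
  "gap_event \<alpha> n \<mu>1 \<mu>2 N C1 C2 p q = {A.
        (\<forall>v<N. node_degree A v > 0) \<and>
        \<bar>(appnp_class_mean \<alpha> n A C2 (class_value C1 \<mu>1 \<mu>2)
            - appnp_class_mean \<alpha> n A C1 (class_value C1 \<mu>1 \<mu>2))
          - ((p + q) / (p + (2 - \<alpha>) / \<alpha> * q)
              + (2 - 2 * \<alpha>) * q / (\<alpha> * p + (2 - \<alpha>) * q)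
                * (1 - \<alpha>) ^ n * ((p - q) / (p + q)) ^ n) * (\<mu>2 - \<mu>1)\<bar>
        \<le> 64 * real n * (\<mu>2 - \<mu>1) / sqrt (real N * (p + q))}"

text \<open>\<open>prob_centered_rows\<close> is used twice: weight 1 controls the degrees, and the
  weight \<open>w2\<close> controls the defect of the class sign.\<close>

lemma prob_gap_event:
  assumes C: "balanced_classes N C1 C2" and N: "N > 0" and pq: "0 < q" "q < p" "p \<le> 1"
    and \<alpha>: "0 < \<alpha>" "\<alpha> < 1" and \<mu>: "\<mu>1 < \<mu>2"
  shows "measure_pmf.prob (sbm N C1 p q) (- gap_event \<alpha> n \<mu>1 \<mu>2 N C1 C2 p q)
    \<le> 8 * real N * exp (- (real N * (p + q) / 128)) + 4 * exp (- real N)"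
proof -
  define d where "d = real N * (p + q) / 2"
  define \<Lambda> where "\<Lambda> = (p - q) / (p + q)"
  define s where "s = class_sign C1"
  define x where "x w v E = (\<Sum>u<N. w v u * (of_bool (E (min v u, max v u)) - edge_prob C1 p q v u))"
    for w :: "nat \<Rightarrow> nat \<Rightarrow> real" and v E
  define bad where "bad w = {E. \<not> ((\<forall>v<N. \<bar>x w v E\<bar> \<le> d / 2) \<and> (\<Sum>v<N. (x w v E)\<^sup>2) \<le> 128 * d * N)}"
    for w
  define w1 :: "nat \<Rightarrow> nat \<Rightarrow> real" where "w1 v u = 1" for v u
  \<comment> \<open>Halved because the difference has absolute value at most 1 + \<Lambda> \<le> 2.
    Undoing this in the squares gives 4 * 128 = 512 below.\<close>
  define w2 where "w2 v u = (s u - \<Lambda> * s v) / 2" for v u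
  have d: "d > 0" unfolding d_def using N pq by (intro divide_pos_pos mult_pos_pos) auto
  have \<Lambda>: "0 \<le> \<Lambda>" "\<Lambda> \<le> 1" using pq by (auto simp: \<Lambda>_def)
  have w2: "\<bar>w2 v u\<bar> \<le> 1" for v u
    using \<Lambda> by (auto simp: w2_def s_def class_sign_def)
  have prob_bad: "measure_pmf.prob (edge_pmf N C1 p q) (bad w)
      \<le> 4 * real N * exp (- (d / 64)) + 2 * exp (- real N)" if "\<And>u v. \<bar>w u v\<bar> \<le> 1" for w
    unfolding bad_def x_def d_def by (rule prob_centered_rows[OF C N _ _ _ _ that]) (use pq in auto)
  have good: "adj_mat N E \<in> gap_event \<alpha> n \<mu>1 \<mu>2 N C1 C2 p q" if E: "E \<notin> bad w1" "E \<notin> bad w2" for E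
  proof -
    define A where "A = adj_mat N E"
    define c where "c n = (p + q) / (p + (2 - \<alpha>) / \<alpha> * q)
      + (2 - 2 * \<alpha>) * q / (\<alpha> * p + (2 - \<alpha>) * q) * (1 - \<alpha>) ^ n * ((p - q) / (p + q)) ^ n" for n
    have A: "A \<in> carrier_mat N N" by (simp add: A_def adj_mat_carrier)
    have deg: "d / 2 \<le> (\<Sum>u<N. A $$ (v, u))" if v: "v < N" for v
    proof -
      have "x w1 v E = (\<Sum>u<N. A $$ (v, u)) - d"
        using sum_edge_prob(1)[OF C v, of p q] v
        by (simp add: x_def w1_def A_def adj_mat_index sum_subtractf d_def)
      moreover have "\<bar>x w1 v E\<bar> \<le> d / 2" using E v by (simp add: bad_def)
      ultimately show ?thesis by linarith
    qed
    have x2: "2 * x w2 v E = (\<Sum>u<N. A $$ (v, u) * s u) - \<Lambda> * s v * (\<Sum>u<N. A $$ (v, u))"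
      if v: "v < N" for v
    proof -
      have "2 * x w2 v E = (\<Sum>u<N. (A $$ (v, u) * s u - \<Lambda> * s v * A $$ (v, u))
          - (edge_prob C1 p q v u * s u - \<Lambda> * s v * edge_prob C1 p q v u))"
        unfolding x_def sum_distrib_left using v
        by (intro sum.cong) (auto simp: w2_def A_def adj_mat_index field_simps)
      also have "\<dots> = (\<Sum>u<N. A $$ (v, u) * s u) - \<Lambda> * s v * (\<Sum>u<N. A $$ (v, u))
          - ((\<Sum>u<N. edge_prob C1 p q v u * s u) - \<Lambda> * s v * (\<Sum>u<N. edge_prob C1 p q v u))"
        by (simp add: sum_subtractf sum_distrib_left)
      \<comment> \<open>The choice of \<Lambda> makes the mean vanish, so the defect involves only
        centred edge variables.\<close>
      also have "(\<Sum>u<N. edge_prob C1 p q v u * s u) - \<Lambda> * s v * (\<Sum>u<N. edge_prob C1 p q v u) = 0"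
        unfolding s_def sum_edge_prob[OF C v] using pq by (simp add: \<Lambda>_def field_simps)
      finally show ?thesis by simp
    qed
    have "(\<Sum>v<N. ((\<Sum>u<N. A $$ (v, u) * s u) - \<Lambda> * s v * (\<Sum>u<N. A $$ (v, u)))\<^sup>2)
        = 4 * (\<Sum>v<N. (x w2 v E)\<^sup>2)"
      by (subst sum_distrib_left, intro sum.cong refl, subst x2[symmetric]) (auto simp: power_mult_distrib)
    also have "\<dots> \<le> 4 * (128 * d * N)" using E by (simp add: bad_def)
    also have "\<dots> = (sqrt 512)\<^sup>2 * d * N" by simp
    finally have "\<bar>appnp_class_mean \<alpha> n A C2 (class_value C1 \<mu>1 \<mu>2)
      - appnp_class_mean \<alpha> n A C1 (class_value C1 \<mu>1 \<mu>2) - c n * (\<mu>2 - \<mu>1)\<bar>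
      \<le> 2 * real n * sqrt 512 * (\<mu>2 - \<mu>1) / sqrt d"
      using appnp_coefficient_Suc[OF \<alpha>, of q p, folded c_def \<Lambda>_def] \<mu> pq deg
      by (intro appnp_class_gap_bound[OF A N _ _ C d _ \<alpha> \<Lambda>, where B = "sqrt 512"])
         (auto simp: A_def adj_mat_index min.commute max.commute s_def)
    \<comment> \<open>As d is half of N (p + q), the constant is 2 sqrt 512 sqrt 2 = 64.\<close>
    also have "\<dots> = 64 * real n * (\<mu>2 - \<mu>1) / sqrt (real N * (p + q))"
    proof -
      have "sqrt 512 * sqrt 2 = (32 :: real)" by (simp flip: real_sqrt_mult)
      moreover have "sqrt d = sqrt (real N * (p + q)) / sqrt 2" by (simp add: d_def real_sqrt_divide)
      ultimately show ?thesis by (simp add: mult.assoc mult.left_commute)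
    qed
    moreover have "node_degree A v > 0" if "v < N" for v
      using deg[OF that] d A by (simp add: node_degree_def)
    ultimately show ?thesis unfolding gap_event_def A_def c_def by simp
  qed
  have "measure_pmf.prob (sbm N C1 p q) (- gap_event \<alpha> n \<mu>1 \<mu>2 N C1 C2 p q)
      = measure_pmf.prob (edge_pmf N C1 p q) (adj_mat N -` (- gap_event \<alpha> n \<mu>1 \<mu>2 N C1 C2 p q))"
    unfolding sbm_def by simp
  also have "\<dots> \<le> measure_pmf.prob (edge_pmf N C1 p q) (bad w1 \<union> bad w2)"
    by (intro measure_pmf.finite_measure_mono) (use good in auto)
  also have "\<dots> \<le> measure_pmf.prob (edge_pmf N C1 p q) (bad w1) + measure_pmf.prob (edge_pmf N C1 p q) (bad w2)"
    by (rule measure_Un_le) auto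
  also have "\<dots> \<le> 2 * (4 * real N * exp (- (d / 64)) + 2 * exp (- real N))"
    using prob_bad[of w1] prob_bad[of w2, OF w2] by (simp add: w1_def)
  finally show ?thesis by (simp add: d_def algebra_simps)
qed

text \<open>The gap has the features averaged out already, so its event is a cylinder over the
  graph, and the feature factor has mass 1.\<close>

lemma prob_csbm_fst:
  assumes "\<sigma> > 0"
  shows "\<P>(G in csbm N C1 p q \<mu>1 \<mu>2 \<sigma>. fst G \<in> S) = measure_pmf.prob (sbm N C1 p q) S"
proof -
  let ?F = "feature_measure N C1 \<mu>1 \<mu>2 \<sigma>"
  interpret F: prob_space ?F
    unfolding feature_measure_def
    by (intro prob_space_PiM) (use assms in \<open>auto intro: prob_space_normal_density\<close>)
  have "{G \<in> space (csbm N C1 p q \<mu>1 \<mu>2 \<sigma>). fst G \<in> S} = S \<times> space ?F"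
    by (auto simp: csbm_def space_pair_measure)
  moreover have "emeasure (csbm N C1 p q \<mu>1 \<mu>2 \<sigma>) (S \<times> space ?F) = emeasure (sbm N C1 p q) S"
    unfolding csbm_def by (subst F.emeasure_pair_measure_Times) (auto simp: F.emeasure_space_1)
  ultimately show ?thesis by (simp add: measure_def)
qed

theorem proposition3:
  fixes \<mu>1 \<mu>2 r :: real and n :: nat
  assumes "\<mu>1 < \<mu>2" and "r > 0"
  shows "\<exists>C::real. \<forall>(\<alpha>::real) (\<sigma>::real) (p :: nat \<Rightarrow> real) (q :: nat \<Rightarrow> real)
      (C1 :: nat \<Rightarrow> nat set) (C2 :: nat \<Rightarrow> nat set).
    0 < \<alpha> \<longrightarrow> \<alpha> < 1 \<longrightarrow> 0 < \<sigma> \<longrightarrow>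
    (\<forall>N. even N \<longrightarrow> balanced_classes N (C1 N) (C2 N)) \<longrightarrow>
    (\<forall>N. even N \<longrightarrow> 0 < q N \<and> q N < p N \<and> p N \<le> 1) \<longrightarrow>
    p \<in> \<omega>[even_at_top](\<lambda>N. ln (real N) / real N) \<longrightarrow>
    q \<in> \<omega>[even_at_top](\<lambda>N. ln (real N) / real N) \<longrightarrow>
    (\<lambda>N. 1 - \<P>(G in csbm N (C1 N) (p N) (q N) \<mu>1 \<mu>2 \<sigma>.
        (\<forall>v<N. node_degree (fst G) v > 0) \<and>
        \<bar>(appnp_class_mean \<alpha> n (fst G) (C2 N) (class_value (C1 N) \<mu>1 \<mu>2)
            - appnp_class_mean \<alpha> n (fst G) (C1 N) (class_value (C1 N) \<mu>1 \<mu>2))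
          - ((p N + q N) / (p N + (2 - \<alpha>) / \<alpha> * q N)
              + (2 - 2 * \<alpha>) * q N / (\<alpha> * p N + (2 - \<alpha>) * q N)
                * (1 - \<alpha>) ^ n * ((p N - q N) / (p N + q N)) ^ n) * (\<mu>2 - \<mu>1)\<bar>
        \<le> C / sqrt (real N * (p N + q N))))
      \<in> O[even_at_top](\<lambda>N. 1 / real N powr r)"
proof (intro exI[where x = "64 * real n * (\<mu>2 - \<mu>1)"] allI impI, goal_cases)
  case (1 \<alpha> \<sigma> p q C1 C2)
  note \<alpha> = 1(1,2) and \<sigma> = 1(3) and C = 1(4) and pq = 1(5) and p = 1(6)
  define F where "F N = gap_event \<alpha> n \<mu>1 \<mu>2 N (C1 N) (C2 N) (p N) (q N)" for N
  have ev: "eventually P even_at_top" if "eventually (\<lambda>N. even N \<longrightarrow> P N) at_top" for P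
    using that by (simp add: eventually_inf_principal)
  \<comment> \<open>With this factor exp (- N (p + q) / 128) is at most N^(- (r + 1)); the extra
    power absorbs the union bound over N nodes. Thus \<open>r\<close> affects only how large N must
    be, not the witness.\<close>
  have "eventually (\<lambda>N. 128 * (r + 1) * norm (ln (real N) / real N) \<le> norm (p N)) even_at_top"
    using landau_omega.smallD[OF p, of "128 * (r + 1)"] assms by simp
  moreover have "eventually (\<lambda>N :: nat. exp (- real N) \<le> 1 / real N powr r) at_top"
    using assms by real_asymp
  then have "eventually (\<lambda>N :: nat. exp (- real N) \<le> 1 / real N powr r) even_at_top"
    by (intro ev) (auto elim: eventually_mono)
  moreover have "eventually (\<lambda>N. N > 0 \<and> even N) even_at_top"
    by (intro ev eventually_mono[OF eventually_gt_at_top[of 0]]) auto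
  ultimately have "eventually (\<lambda>N. norm (1 - measure_pmf.prob (sbm N (C1 N) (p N) (q N)) (F N))
      \<le> 12 * norm (1 / real N powr r)) even_at_top"
  proof eventually_elim
    case (elim N)
    have N: "N > 0" "even N" and pqN: "0 < q N" "q N < p N" "p N \<le> 1" using elim pq by auto
    have "128 * (r + 1) * (ln (real N) / real N) \<le> p N"
      using elim N pqN by simp
    then have "128 * (r + 1) * ln (real N) \<le> real N * p N"
      using N by (simp add: field_simps)
    also have "\<dots> \<le> real N * (p N + q N)" using pqN by (intro mult_left_mono) auto
    finally have "exp (- (real N * (p N + q N) / 128)) \<le> exp (- ((r + 1) * ln (real N)))"
      by (simp add: algebra_simps)
    also have "\<dots> = real N powr (- (r + 1))" using N by (simp add: powr_def algebra_simps)
    finally have "8 * real N * exp (- (real N * (p N + q N) / 128)) \<le> 8 * real N * real N powr (- (r + 1))"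
      by (intro mult_left_mono) auto
    also have "\<dots> = 8 * (1 / real N powr r)"
      using N by (simp add: powr_diff powr_minus field_simps)
    finally have "measure_pmf.prob (sbm N (C1 N) (p N) (q N)) (- F N) \<le> 12 * (1 / real N powr r)"
      using prob_gap_event[OF C[rule_format, OF N(2)] N(1) pqN \<alpha> assms(1), of n] elim
      unfolding F_def by linarith
    moreover have "measure_pmf.prob (sbm N (C1 N) (p N) (q N)) (- F N)
        = 1 - measure_pmf.prob (sbm N (C1 N) (p N) (q N)) (F N)"
      using measure_pmf.prob_compl[of "F N" "sbm N (C1 N) (p N) (q N)"] by (simp add: Compl_eq_Diff_UNIV)
    ultimately show ?case by simp
  qed
  then have "(\<lambda>N. 1 - measure_pmf.prob (sbm N (C1 N) (p N) (q N)) (F N))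
      \<in> O[even_at_top](\<lambda>N. 1 / real N powr r)" by (rule bigoI)
  then show ?case
    unfolding prob_csbm_fst[OF \<sigma>, of _ _ _ _ \<mu>1 \<mu>2, symmetric] F_def gap_event_def mem_Collect_eq .
qed

end
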